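(* Consider the $(L,R)$-random walk $(X_m)_{m\in\mathbb{N}}$ on $\mathbb{Z}$ described in the context, with $M=\max(L,R)$, and let $F\subset\mathbb{Z}$. The generating functions $K_i$, $i\in\{0,\dots,M-1\}$, satisfy the system $$K_i(x,y)=x\sum_{j=0}^{M-1}\Big(p_{ij}+\sum_{k=M}^{2M-1}p_{ik}H_{kj}^{\rm o}(x)+\sum_{k=-M}^{-1}p_{ik}H_{kj}^{\rm o}(y)\Big)K_j(x,y)+K_i(x,0)+K_i(0,y)-\mathbf{1}_F(i)-x\sum_{j=0}^{M-1}\Big(p_{ij}+\sum_{k=M}^{2M-1}p_{ik}H_{kj}^{\rm o}(x)\Big)K_j(x,0),\quad 0\le i\le M-1,$$ where $$K_i(x,0)=G_i(x)-\sum_{j=0}^{M-1}H_{i+M\,j}^{\rm o}(x)\,G_{j-M}(x),$$ $$K_i(0,y)=G_i(y)-y\sum_{j=0}^{2M-1}p_{ij}G_j(y)-y\sum_{j=0}^{M-1}\sum_{k=-M}^{-1}p_{ik}H_{kj}^{\rm o}(y)G_j(y),$$ and where the functions $H_{ij}^{\rm o}$ solve the systems $$\sum_{k=0}^{M-1}H_{ik}^{\rm o}(x)G_{kj}(x)=G_{ij}(x),\quad M\le i\le 2M-1,\ 0\le j\le M-1,$$ $$\sum_{k=0}^{M-1}H_{ik}^{\rm o}(y)G_{kj}(y)=G_{ij}(y),\quad -M\le i\le -1,\ 0\le j\le M-1.$$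
   Context: $L,R$ are positive integers, $M=\max(L,R)$, $(U_\ell)_{\ell\ge1}$ are i.i.d. random variables with values in $\{-L,-L+1,\dots,R\}$, $\pi_i=\mathbb{P}\{U_1=i\}$ for $i\in\{-L,\dots,R\}$ and $\pi_i=0$ for other integers $i$. $X_0$ is an integer and $X_m=X_0+\sum_{\ell=1}^mU_\ell$; this is a Markov chain on $\mathbb{Z}$ with transition probabilities $p_{ij}=\pi_{j-i}$. $\mathbb{P}_i,\mathbb{E}_i$ refer to the start $X_0=i$; $\mathbf{1}_F$ is the indicator of $F$; $\mathbb{N}=\{0,1,2,\dots\}$. $T_0=0$ and $T_n=\#\{m\in\{1,\dots,n\}:X_m\ge0\}$ for $n\ge 1$; $\tau^{\rm o}=\min\{m\ge1:X_m\in\{0,1,\dots,M-1\}\}$ (with $\min\varnothing=+\infty$). $G_{ij}(x)=\sum_{m\ge0}\mathbb{P}_i\{X_m=j\}x^m$; $G_i(x)=\sum_{m\ge0}\mathbb{P}_i\{X_m\in F\}x^m$; $H_{ij}^{\rm o}(x)=\mathbb{E}_i\big(x^{\tau^{\rm o}}\mathbf{1}_{\{\tau^{\rm o}<\infty,\,X_{\tau^{\rm o}}=j\}}\big)$; $K_i(x,y)=\sum_{m,n\in\mathbb{N}:\,m\le n}\mathbb{P}_i\{T_n=m,X_n\in F\}x^my^{n-m}$ (with $0^0=1$). Identities are understood for real $x,y$ such that all the series involved converge absolutely (in particular for $|x|<1$, $|y|<1$). *)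

theory Defs
  imports "HOL-Probability.Probability"
begin

locale LR_walk = prob_space P for P :: "'a measure" +
  fixes L R :: int and U :: "nat \<Rightarrow> 'a \<Rightarrow> int"
  assumes L_pos: "L \<ge> 1"
    and R_pos: "R \<ge> 1"
    and steps_indep: "indep_vars (\<lambda>_. count_space UNIV) U {1..}"
    and steps_ident: "\<And>l. l \<ge> 1 \<Longrightarrow>
      distr P (count_space UNIV) (U l) = distr P (count_space UNIV) (U 1)"
    and steps_range: "\<And>l \<omega>. l \<ge> 1 \<Longrightarrow> \<omega> \<in> space P \<Longrightarrow> U l \<omega> \<in> {-L..R}"

(* X_m under P_i: the starting point i is a parameter of the path, so that every probability
   P_i and expectation E_i below is taken with respect to the single measure P. *)
definition walk :: "(nat \<Rightarrow> 'a \<Rightarrow> int) \<Rightarrow> int \<Rightarrow> nat \<Rightarrow> 'a \<Rightarrow> int" where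
  "walk U i m \<omega> = i + (\<Sum>l=1..m. U l \<omega>)"

definition step_prob :: "'a measure \<Rightarrow> int \<Rightarrow> int \<Rightarrow> (nat \<Rightarrow> 'a \<Rightarrow> int) \<Rightarrow> int \<Rightarrow> real" where
  "step_prob P L R U k = (if k \<in> {-L..R} then \<P>(\<omega> in P. U 1 \<omega> = k) else 0)"

definition trans_prob :: "'a measure \<Rightarrow> int \<Rightarrow> int \<Rightarrow> (nat \<Rightarrow> 'a \<Rightarrow> int) \<Rightarrow> int \<Rightarrow> int \<Rightarrow> real" where
  "trans_prob P L R U i j = step_prob P L R U (j - i)"

definition sojourn :: "(nat \<Rightarrow> 'a \<Rightarrow> int) \<Rightarrow> int \<Rightarrow> nat \<Rightarrow> 'a \<Rightarrow> nat" where
  "sojourn U i n \<omega> = card {m \<in> {1..n}. walk U i m \<omega> \<ge> 0}"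

(* The infimum of the empty set in enat is infinity. *)
definition hit_time :: "(nat \<Rightarrow> 'a \<Rightarrow> int) \<Rightarrow> int \<Rightarrow> int \<Rightarrow> 'a \<Rightarrow> enat" where
  "hit_time U M i \<omega> = (INF m \<in> {m. m \<ge> 1 \<and> walk U i m \<omega> \<in> {0..M-1}}. enat m)"

definition G_term :: "'a measure \<Rightarrow> (nat \<Rightarrow> 'a \<Rightarrow> int) \<Rightarrow> int \<Rightarrow> int \<Rightarrow> real \<Rightarrow> nat \<Rightarrow> real" where
  "G_term P U i j x m = \<P>(\<omega> in P. walk U i m \<omega> = j) * x ^ m"

definition G_conv :: "'a measure \<Rightarrow> (nat \<Rightarrow> 'a \<Rightarrow> int) \<Rightarrow> int \<Rightarrow> int \<Rightarrow> real \<Rightarrow> bool" where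
  "G_conv P U i j x \<longleftrightarrow> summable (\<lambda>m. \<bar>G_term P U i j x m\<bar>)"

definition G_fun :: "'a measure \<Rightarrow> (nat \<Rightarrow> 'a \<Rightarrow> int) \<Rightarrow> int \<Rightarrow> int \<Rightarrow> real \<Rightarrow> real" where
  "G_fun P U i j x = (\<Sum>m. G_term P U i j x m)"

definition GF_term :: "'a measure \<Rightarrow> (nat \<Rightarrow> 'a \<Rightarrow> int) \<Rightarrow> int set \<Rightarrow> int \<Rightarrow> real \<Rightarrow> nat \<Rightarrow> real" where
  "GF_term P U F i x m = \<P>(\<omega> in P. walk U i m \<omega> \<in> F) * x ^ m"

definition GF_conv :: "'a measure \<Rightarrow> (nat \<Rightarrow> 'a \<Rightarrow> int) \<Rightarrow> int set \<Rightarrow> int \<Rightarrow> real \<Rightarrow> bool" where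
  "GF_conv P U F i x \<longleftrightarrow> summable (\<lambda>m. \<bar>GF_term P U F i x m\<bar>)"

definition GF_fun :: "'a measure \<Rightarrow> (nat \<Rightarrow> 'a \<Rightarrow> int) \<Rightarrow> int set \<Rightarrow> int \<Rightarrow> real \<Rightarrow> real" where
  "GF_fun P U F i x = (\<Sum>m. GF_term P U F i x m)"

definition H_term :: "(nat \<Rightarrow> 'a \<Rightarrow> int) \<Rightarrow> int \<Rightarrow> int \<Rightarrow> int \<Rightarrow> real \<Rightarrow> 'a \<Rightarrow> real" where
  "H_term U M i j x \<omega> = x ^ the_enat (hit_time U M i \<omega>) *
     indicator {\<omega>. hit_time U M i \<omega> < \<infinity> \<and> walk U i (the_enat (hit_time U M i \<omega>)) \<omega> = j} \<omega>"

(* Integrability amounts to absolute convergence of the power series of this expectation,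
   whose m-th coefficient is the probability that hit_time = m and X_m = j. *)
definition H_conv :: "'a measure \<Rightarrow> (nat \<Rightarrow> 'a \<Rightarrow> int) \<Rightarrow> int \<Rightarrow> int \<Rightarrow> int \<Rightarrow> real \<Rightarrow> bool" where
  "H_conv P U M i j x \<longleftrightarrow> integrable P (H_term U M i j x)"

definition H_fun :: "'a measure \<Rightarrow> (nat \<Rightarrow> 'a \<Rightarrow> int) \<Rightarrow> int \<Rightarrow> int \<Rightarrow> int \<Rightarrow> real \<Rightarrow> real" where
  "H_fun P U M i j x = (LINT \<omega>|P. H_term U M i j x \<omega>)"

definition K_term ::
  "'a measure \<Rightarrow> (nat \<Rightarrow> 'a \<Rightarrow> int) \<Rightarrow> int set \<Rightarrow> int \<Rightarrow> real \<Rightarrow> real \<Rightarrow> nat \<times> nat \<Rightarrow> real" where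
  "K_term P U F i x y = (\<lambda>(m, n).
     \<P>(\<omega> in P. sojourn U i n \<omega> = m \<and> walk U i n \<omega> \<in> F) * x ^ m * y ^ (n - m))"

definition K_conv :: "'a measure \<Rightarrow> (nat \<Rightarrow> 'a \<Rightarrow> int) \<Rightarrow> int set \<Rightarrow> int \<Rightarrow> real \<Rightarrow> real \<Rightarrow> bool" where
  "K_conv P U F i x y \<longleftrightarrow> (\<lambda>q. \<bar>K_term P U F i x y q\<bar>) summable_on {(m, n). m \<le> n}"

definition K_fun :: "'a measure \<Rightarrow> (nat \<Rightarrow> 'a \<Rightarrow> int) \<Rightarrow> int set \<Rightarrow> int \<Rightarrow> real \<Rightarrow> real \<Rightarrow> real" where
  "K_fun P U F i x y = (\<Sum>\<^sub>\<infinity>q\<in>{(m, n). m \<le> n}. K_term P U F i x y q)"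

end

theory Submission
  imports Defs
begin

text \<open>
  Every generating function of the theorem is the total weight of a language of words. A word is the
  list of steps of a finite piece of the walk; its weight is the product of its step probabilities
  and of one factor for each site it lands on. The constant factor \<open>x\<close> marks time, which gives
  \<open>G\<close> and \<open>H\<close>; the factor \<open>x\<close> on the nonnegative sites and \<open>y\<close> on the negative ones
  marks the sojourn time, which gives \<open>K\<close>. The weight is multiplicative under concatenation, so an
  unambiguous factorisation of a language becomes an identity between sums. This replaces the Markov
  property: independence and equal distribution of the steps enter only once, in the product formula
  for the law of the random word.

  The factorisation used throughout is first passage (\<open>first_passage\<close>): a path either avoids a set
  \<open>C\<close>, or splits uniquely at its first visit to \<open>C\<close>. Take for \<open>C\<close> the band
  \<open>{0..M-1}\<close>. Since no step is longer than \<open>M\<close>, the walk cannot jump over the band, so between two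
  visits it stays on one side of it.

  \<^item> An excursion above the band is weighted by \<open>x\<close> only, one below by \<open>y\<close> except for its
    last step, which lands on a nonnegative site. This turns the weight of the first return into
    the coefficient of \<open>K\<^sub>j(x,y)\<close> (\<open>return_gf\<close>). A path that does not return stays on
    one side after its start, so its weight at \<open>(x,y)\<close> is already visible at \<open>(x,0)\<close> and \<open>(0,y)\<close>, the
    empty path being counted twice (\<open>sojourn_gf_system\<close>).
  \<^item> \<open>K\<^sub>i(x,0)\<close> counts the paths without a visit to the negative half-line. Its complement
    among all paths is found by first passage into that half-line; translated by \<open>M\<close>, this is the
    entrance into the band from above (\<open>nonneg_gf\<close>).
  \<^item> \<open>K\<^sub>i(0,y)\<close> counts, besides the empty path, the paths that step below the band at once and
    never reach it again; the first step and first passage into the band give the formula (\<open>negative_gf\<close>).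
  \<^item> A path that starts outside the band and ends in it must enter it, which gives the systems
    for \<open>H\<close> (\<open>hitting_gf_system\<close>).

  Absolute convergence of the series in the theorem is unconditional summability over the
  corresponding language, because all words contributing to one coefficient carry the same power of
  the variables and nonnegative probabilities. Hence the identities hold wherever the series
  converge, not only inside the unit disc.
\<close>

section \<open>Weighted words of steps\<close>

text \<open>
  The first letter moves the walk from \<open>i\<close> to \<open>i + u\<close>, so the factor \<open>c\<close> is charged for
  every site visited at a positive time and never for the starting site.
\<close>
primrec path_weight :: "(int \<Rightarrow> real) \<Rightarrow> (int \<Rightarrow> real) \<Rightarrow> int \<Rightarrow> int list \<Rightarrow> real" where
  "path_weight p c i [] = 1"
| "path_weight p c i (u # us) = p u * c (i + u) * path_weight p c (i + u) us"

text \<open>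
  Like the hitting time, avoidance and entrance only look at positive times: the walk may start
  in \<open>C\<close>.
\<close>
primrec avoids :: "int set \<Rightarrow> int \<Rightarrow> int list \<Rightarrow> bool" where
  "avoids C i [] \<longleftrightarrow> True"
| "avoids C i (u # us) \<longleftrightarrow> i + u \<notin> C \<and> avoids C (i + u) us"

primrec enters :: "int set \<Rightarrow> int \<Rightarrow> int list \<Rightarrow> bool" where
  "enters C i [] \<longleftrightarrow> False"
| "enters C i (u # us) \<longleftrightarrow> (if i + u \<in> C then us = [] else enters C (i + u) us)"

abbreviation split_value :: "real \<Rightarrow> real \<Rightarrow> int \<Rightarrow> real" where
  "split_value x y k \<equiv> if 0 \<le> k then x else y"

lemma path_weight_append:
  "path_weight p c i (us @ vs) = path_weight p c i us * path_weight p c (i + sum_list us) vs"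
  by (induction us arbitrary: i) (simp_all add: add.assoc)

lemma enters_endpoint: "enters C i us \<Longrightarrow> i + sum_list us \<in> C"
proof (induction us arbitrary: i)
  case (Cons u us)
  then show ?case by (cases "i + u \<in> C") (auto simp: add.assoc[symmetric])
qed simp

lemma enters_not_avoids: "enters C i us \<Longrightarrow> \<not> avoids C i (us @ vs)"
  by (induction us arbitrary: i) (auto split: if_splits)

text \<open>
  No proper prefix of a first-entrance word is a first-entrance word; this makes the first-passage
  factorisation unambiguous.
\<close>
lemma enters_unique:
  assumes "enters C i us" "enters C i us'" "us @ vs = us' @ vs'"
  shows "us = us' \<and> vs = vs'"
  using assms
proof (induction us arbitrary: i us')
  case (Cons u us)
  then obtain ws where us': "us' = u # ws" by (cases us') auto
  show ?case
  proof (cases "i + u \<in> C")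
    case True
    then show ?thesis using Cons.prems us' by auto
  next
    case False
    then show ?thesis using Cons.prems Cons.IH[of "i + u" ws] us' by auto
  qed
qed simp

lemma not_avoids_decompose:
  "\<not> avoids C i ws \<Longrightarrow> \<exists>us vs. ws = us @ vs \<and> enters C i us"
proof (induction ws arbitrary: i)
  case (Cons w ws)
  show ?case
  proof (cases "i + w \<in> C")
    case True
    then have "w # ws = [w] @ ws \<and> enters C i [w]" by simp
    then show ?thesis by blast
  next
    case False
    with Cons.prems have "\<not> avoids C (i + w) ws" by simp
    then obtain us vs where "ws = us @ vs" "enters C (i + w) us"
      using Cons.IH by blast
    then have "w # ws = (w # us) @ vs \<and> enters C i (w # us)" using False by simp
    then show ?thesis by blast
  qed
qed simp

lemma path_weight_const_shift: "path_weight p (\<lambda>_. x) i us = path_weight p (\<lambda>_. x) k us"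
  by (induction us arbitrary: i k) auto

text \<open>
  Setting the factor to zero on \<open>C\<close> selects the paths that avoid \<open>C\<close>. With
  \<open>path_weight_cong_avoids\<close> this is how the specialisations \<open>x = 0\<close> and \<open>y = 0\<close> of the
  sojourn generating function are read as counts of paths that stay on one side of the origin.
\<close>
lemma path_weight_kills_visit:
  "(\<And>k. k \<in> C \<Longrightarrow> c k = 0) \<Longrightarrow> \<not> avoids C i us \<Longrightarrow> path_weight p c i us = 0"
  by (induction us arbitrary: i) auto

lemma path_weight_cong_avoids:
  "(\<And>k. k \<notin> C \<Longrightarrow> c k = d k) \<Longrightarrow> avoids C i us \<Longrightarrow> path_weight p c i us = path_weight p d i us"
  by (induction us arbitrary: i) auto

lemma has_sum_Cons_images:
  fixes f :: "'b list \<Rightarrow> real"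
  assumes "finite S" and "\<And>u. u \<in> S \<Longrightarrow> ((\<lambda>us. f (u # us)) has_sum h u) (B u)"
  shows "(f has_sum (\<Sum>u\<in>S. h u)) (\<Union>u\<in>S. Cons u ` B u)"
proof (rule sum_has_sum[OF assms(1)])
  fix u assume "u \<in> S"
  have "inj_on (Cons u) (B u)" by simp
  then show "(f has_sum h u) (Cons u ` B u)"
    using assms(2)[OF \<open>u \<in> S\<close>] by (subst has_sum_reindex) (simp_all add: o_def)
qed auto

lemma has_sum_times:
  fixes f :: "'b \<Rightarrow> real" and g :: "'c \<Rightarrow> real"
  assumes "(f has_sum a) A" "(g has_sum b) B"
  shows "((\<lambda>(u, v). f u * g v) has_sum a * b) (A \<times> B)"
proof -
  have "(\<lambda>u. norm (f u)) summable_on A" "(\<lambda>v. norm (g v)) summable_on B"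
    using assms summable_on_iff_abs_summable_on_real has_sum_imp_summable by blast+
  then have "(\<lambda>(u, v). norm (f u) * norm (g v)) summable_on A \<times> B"
    by (intro summable_on_SigmaI[where g = "\<lambda>u. norm (f u) * infsum (\<lambda>v. norm (g v)) B"])
      (auto intro!: has_sum_cmult_right has_sum_infsum summable_on_cmult_left)
  then have "(\<lambda>q. norm (case q of (u, v) \<Rightarrow> f u * g v)) summable_on A \<times> B"
    by (simp add: case_prod_unfold abs_mult)
  then have "(\<lambda>(u, v). f u * g v) summable_on A \<times> B"
    by (rule abs_summable_summable)
  then show ?thesis
    using assms by (intro has_sum_SigmaI[where g = "\<lambda>u. f u * b"])
      (auto intro: has_sum_cmult_right has_sum_cmult_left)
qed

section \<open>First passage for walks with bounded steps\<close>

text \<open>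
  Steps longer than \<open>M\<close> have weight zero. Words are taken over the symmetric range
  \<open>{-M..M}\<close>, so that \<open>M\<close> is the only parameter of the languages.
\<close>
locale bounded_steps =
  fixes p :: "int \<Rightarrow> real" and M :: int
  assumes p_outside: "\<And>u. \<bar>u\<bar> > M \<Longrightarrow> p u = 0"
begin

abbreviation band :: "int set" where
  "band \<equiv> {0..M-1}"

text \<open>
  The starting point comes last in \<open>paths\<close>, \<open>avoiding\<close> and \<open>entries\<close>, because it is
  also an argument of the weight: \<open>converges\<close> and \<open>gf\<close> supply the same point to both.
\<close>
definition paths :: "int set \<Rightarrow> int \<Rightarrow> int list set" where
  "paths F i = {us \<in> lists {-M..M}. i + sum_list us \<in> F}"

definition avoiding :: "int set \<Rightarrow> int set \<Rightarrow> int \<Rightarrow> int list set" where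
  "avoiding C F i = {us \<in> paths F i. avoids C i us}"

definition entries :: "int set \<Rightarrow> int \<Rightarrow> int \<Rightarrow> int list set" where
  "entries C j i = {us \<in> paths {j} i. enters C i us}"

abbreviation converges :: "(int \<Rightarrow> real) \<Rightarrow> (int \<Rightarrow> int list set) \<Rightarrow> int \<Rightarrow> bool" where
  "converges c A i \<equiv> path_weight p c i summable_on A i"

abbreviation gf :: "(int \<Rightarrow> real) \<Rightarrow> (int \<Rightarrow> int list set) \<Rightarrow> int \<Rightarrow> real" where
  "gf c A i \<equiv> infsum (path_weight p c i) (A i)"

lemma paths_first_passage:
  assumes "\<And>us. us \<in> lists {-M..M} \<Longrightarrow> enters C i us \<Longrightarrow> i + sum_list us \<in> J"
  shows "paths F i = avoiding C F i \<union> (\<Union>j\<in>J. (\<lambda>(us, vs). us @ vs) ` (entries C j i \<times> paths F j))"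
    (is "_ = ?R")
proof (intro Set.equalityI subsetI)
  fix ws assume ws: "ws \<in> paths F i"
  show "ws \<in> ?R"
  proof (cases "avoids C i ws")
    case False
    then obtain us vs where d: "ws = us @ vs" "enters C i us"
      using not_avoids_decompose by blast
    with ws have "us \<in> entries C (i + sum_list us) i" "vs \<in> paths F (i + sum_list us)"
      by (auto simp: entries_def paths_def add.assoc)
    moreover have "i + sum_list us \<in> J"
      using assms d ws by (auto simp: paths_def)
    ultimately show ?thesis using d by force
  qed (use ws in \<open>simp add: avoiding_def\<close>)
qed (auto simp: avoiding_def entries_def paths_def add.assoc)

text \<open>
  Concatenation identifies the paths that visit \<open>C\<close> with pairs of an entrance word and an onward
  path. The set \<open>J\<close> of possible entrance sites is separate from \<open>C\<close>, since bounded steps make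
  it finite even when \<open>C\<close> is a half-line.
\<close>
lemma first_passage:
  assumes J: "finite J" "\<And>us. us \<in> lists {-M..M} \<Longrightarrow> enters C i us \<Longrightarrow> i + sum_list us \<in> J"
    and total: "converges c (paths F) i"
    and entries: "\<And>j. j \<in> J \<Longrightarrow> converges c (entries C j) i"
    and onward: "\<And>j. j \<in> J \<Longrightarrow> converges c (paths F) j"
  shows "gf c (paths F) i = gf c (avoiding C F) i + (\<Sum>j\<in>J. gf c (entries C j) i * gf c (paths F) j)"
proof -
  let ?app = "\<lambda>(us, vs). us @ vs :: int list"
  have part: "(path_weight p c i has_sum gf c (entries C j) i * gf c (paths F) j)
      (?app ` (entries C j i \<times> paths F j))" if "j \<in> J" for j
  proof -
    have inj: "inj_on ?app (entries C j i \<times> paths F j)"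
      by (auto simp: inj_on_def entries_def dest: enters_unique)
    have "((\<lambda>(us, vs). path_weight p c i us * path_weight p c j vs) has_sum
        gf c (entries C j) i * gf c (paths F) j) (entries C j i \<times> paths F j)"
      using entries[OF that] onward[OF that] by (intro has_sum_times has_sum_infsum)
    then have "((path_weight p c i \<circ> ?app) has_sum
        gf c (entries C j) i * gf c (paths F) j) (entries C j i \<times> paths F j)"
      by (rule has_sum_cong[THEN iffD1, rotated])
        (auto simp: entries_def paths_def path_weight_append)
    then show ?thesis using inj by (simp add: has_sum_reindex)
  qed
  have decomp: "paths F i = avoiding C F i \<union> (\<Union>j\<in>J. ?app ` (entries C j i \<times> paths F j))"
    using J(2) by (rule paths_first_passage)
  have "(path_weight p c i has_sum (\<Sum>j\<in>J. gf c (entries C j) i * gf c (paths F) j))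
      (\<Union>j\<in>J. ?app ` (entries C j i \<times> paths F j))"
  proof (rule sum_has_sum[OF J(1) part])
    show "?app ` (entries C j i \<times> paths F j) \<inter> ?app ` (entries C j' i \<times> paths F j') = {}"
      if "j \<noteq> j'" for j j'
    proof -
      have "us @ vs \<noteq> us' @ vs'" if "us \<in> entries C j i" "us' \<in> entries C j' i" for us vs us' vs'
        using that \<open>j \<noteq> j'\<close> enters_unique[of C i us us' vs vs'] by (auto simp: entries_def paths_def)
      then show ?thesis by auto
    qed
  qed
  moreover have "(path_weight p c i has_sum gf c (avoiding C F) i) (avoiding C F i)"
    using total by (intro has_sum_infsum summable_on_subset_banach[OF total]) (auto simp: avoiding_def)
  moreover have "avoiding C F i \<inter> (\<Union>j\<in>J. ?app ` (entries C j i \<times> paths F j)) = {}"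
    by (auto simp: avoiding_def entries_def dest: enters_not_avoids)
  ultimately show ?thesis
    by (subst decomp) (intro infsumI has_sum_Un_disjoint)
qed

text \<open>
  From the band the walk reaches only the sites from \<open>-M\<close> to \<open>2*M-1\<close>, so the sum over steps can
  be written as a sum over this window, which does not depend on the starting point.
\<close>
lemma sum_over_steps:
  assumes "i \<in> band" "\<And>k. \<bar>k - i\<bar> > M \<Longrightarrow> h k = (0 :: real)"
  shows "(\<Sum>u=-M..M. h (i + u)) = (\<Sum>k=-M..2*M-1. h k)"
proof -
  have "(\<Sum>u=-M..M. h (i + u)) = sum h {i-M..i+M}"
    by (rule sum.reindex_bij_witness[of _ "\<lambda>k. k - i" "\<lambda>u. i + u"]) auto
  also have "\<dots> = sum h {-M..2*M-1}"
    using assms by (intro sum.mono_neutral_left) auto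
  finally show ?thesis .
qed

lemma paths_first_step:
  "paths F i = (if i \<in> F then {[]} else {}) \<union> (\<Union>u\<in>{-M..M}. Cons u ` paths F (i + u))"
proof (rule set_eqI)
  fix ws
  show "ws \<in> paths F i \<longleftrightarrow>
    ws \<in> (if i \<in> F then {[]} else {}) \<union> (\<Union>u\<in>{-M..M}. Cons u ` paths F (i + u))"
    by (cases ws) (auto simp: paths_def add.assoc)
qed

text \<open>
  The paths through a successor form a subfamily of a summable family. So the total weight of the
  successor converges or has coefficient zero.
\<close>
lemma gf_paths_first_step:
  assumes i: "i \<in> band" and conv: "converges c (paths F) i"
  shows "gf c (paths F) i =
    indicator F i + (\<Sum>k=-M..2*M-1. p (k - i) * c k * gf c (paths F) k)"
proof -
  have "((\<lambda>us. path_weight p c i (u # us)) has_sum p u * c (i + u) * gf c (paths F) (i + u))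
      (paths F (i + u))" if "u \<in> {-M..M}" for u
  proof -
    have "path_weight p c i summable_on Cons u ` paths F (i + u)"
      using that by (intro summable_on_subset_banach[OF conv]) (auto simp: paths_first_step[of F i])
    then have "(\<lambda>us. path_weight p c i (u # us)) summable_on paths F (i + u)"
      by (subst (asm) summable_on_reindex) (auto simp: o_def)
    then show ?thesis
      by (simp add: has_sum_infsum infsum_cmult_right'[symmetric])
  qed
  then have "(path_weight p c i has_sum
      (\<Sum>u=-M..M. p u * c (i + u) * gf c (paths F) (i + u)))
      (\<Union>u\<in>{-M..M}. Cons u ` paths F (i + u))"
    by (intro has_sum_Cons_images) auto
  moreover have "(path_weight p c i has_sum indicator F i) (if i \<in> F then {[]} else {})"
    by (auto intro: has_sum_finiteI)
  ultimately have "(path_weight p c i has_sum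
      indicator F i + (\<Sum>u=-M..M. p u * c (i + u) * gf c (paths F) (i + u))) (paths F i)"
    unfolding paths_first_step[of F i] by (intro has_sum_Un_disjoint) auto
  moreover have "(\<Sum>u=-M..M. p u * c (i + u) * gf c (paths F) (i + u)) =
      (\<Sum>k=-M..2*M-1. p (k - i) * c k * gf c (paths F) k)"
    using sum_over_steps[OF i, of "\<lambda>k. p (k - i) * c k * gf c (paths F) k"] p_outside by simp
  ultimately have "(path_weight p c i has_sum
      indicator F i + (\<Sum>k=-M..2*M-1. p (k - i) * c k * gf c (paths F) k)) (paths F i)"
    by simp
  then show ?thesis by (rule infsumI)
qed

text \<open>
  Convergence is inherited along a step that contributes; this carries it from the band to the sites
  below.
\<close>
lemma converges_paths_next:
  assumes conv: "converges c (paths F) i" and "p (k - i) * c k \<noteq> 0"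
  shows "converges c (paths F) k"
proof -
  have "k - i \<in> {-M..M}" using assms p_outside[of "k - i"] by fastforce
  then have "path_weight p c i summable_on Cons (k - i) ` paths F k"
    by (intro summable_on_subset_banach[OF conv]) (force simp: paths_first_step[of F i])
  then have "(\<lambda>us. (p (k - i) * c k) * path_weight p c k us) summable_on paths F k"
    by (subst (asm) summable_on_reindex) (auto simp: o_def)
  then show ?thesis using assms(2) by (simp add: summable_on_cmult_right')
qed

lemma entries_first_step:
  "entries C j i = (\<Union>u\<in>{-M..M}. Cons u `
     (if i + u \<in> C then if i + u = j then {[]} else {} else entries C j (i + u)))"
proof (rule set_eqI)
  fix ws
  show "ws \<in> entries C j i \<longleftrightarrow> ws \<in> (\<Union>u\<in>{-M..M}. Cons u `
     (if i + u \<in> C then if i + u = j then {[]} else {} else entries C j (i + u)))"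
    by (cases ws) (auto simp: entries_def paths_def add.assoc image_iff split: if_splits)
qed

section \<open>Excursions from the band\<close>

text \<open>
  A step is too short to cross the band, so an entrance from above visits nonnegative sites only.
\<close>
lemma weight_above_entry:
  assumes "M \<le> i" "us \<in> lists {-M..M}" "enters band i us"
  shows "path_weight p (split_value x y) i us = path_weight p (\<lambda>_. x) i us"
  using assms
proof (induction us arbitrary: i)
  case (Cons u us)
  then have "0 \<le> i + u" by auto
  then show ?case using Cons by (cases "i + u \<in> band") auto
qed simp

text \<open>
  An entrance from below visits negative sites except for its last one. Multiplying by \<open>y\<close> avoids a
  division, so that \<open>y = 0\<close> is covered.
\<close>
lemma weight_below_entry:
  assumes "i < 0" "us \<in> lists {-M..M}" "enters band i us"
  shows "y * path_weight p (split_value x y) i us = x * path_weight p (\<lambda>_. y) i us"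
  using assms
proof (induction us arbitrary: i)
  case (Cons u us)
  show ?case
  proof (cases "i + u \<in> band")
    case False
    then have "i + u < 0" "enters band (i + u) us" "us \<in> lists {-M..M}" using Cons.prems by auto
    from Cons.IH[OF this(1,3,2)] \<open>i + u < 0\<close> show ?thesis by (simp add: mult.left_commute mult.assoc)
  qed (use Cons.prems in auto)
qed simp

lemma weight_above_avoiding:
  assumes "M \<le> i" "us \<in> lists {-M..M}" "avoids band i us"
  shows "path_weight p (split_value x y) i us = path_weight p (\<lambda>_. x) i us"
  using assms
proof (induction us arbitrary: i)
  case (Cons u us)
  then have "M \<le> i + u" by auto
  then show ?case using Cons by auto
qed simp

lemma weight_below_avoiding:
  assumes "i < 0" "us \<in> lists {-M..M}" "avoids band i us"
  shows "path_weight p (split_value x y) i us = path_weight p (\<lambda>_. y) i us"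
  using assms
proof (induction us arbitrary: i)
  case (Cons u us)
  then have "i + u < 0" by auto
  then show ?case using Cons by auto
qed simp

text \<open>
  The first step leads into the band, above it or below it. In the last case the step contributes the
  factor \<open>y\<close>, which is exchanged for the factor \<open>x\<close> of the final step of the excursion.
\<close>
lemma return_gf:
  assumes i: "i \<in> band" and j: "j \<in> band"
    and above: "\<And>k. k \<in> {M..2*M-1} \<Longrightarrow> converges (\<lambda>_. x) (entries band j) k"
    and below: "\<And>k. k \<in> {-M..-1} \<Longrightarrow> converges (\<lambda>_. y) (entries band j) k"
  shows "converges (split_value x y) (entries band j) i"
    and "gf (split_value x y) (entries band j) i =
      x * (p (j - i) + (\<Sum>k=M..2*M-1. p (k - i) * gf (\<lambda>_. x) (entries band j) k)
                     + (\<Sum>k=-M..-1. p (k - i) * gf (\<lambda>_. y) (entries band j) k))"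
proof -
  \<comment> \<open>The weight of the first returns at j whose first step leads to k.\<close>
  define h where "h k = x * (p (k - i) * (if k \<in> band then if k = j then 1 else 0
      else if M \<le> k then gf (\<lambda>_. x) (entries band j) k else gf (\<lambda>_. y) (entries band j) k))" for k
  have step: "((\<lambda>us. path_weight p (split_value x y) i (u # us)) has_sum h (i + u))
     (if i + u \<in> band then if i + u = j then {[]} else {} else entries band j (i + u))"
    if u: "u \<in> {-M..M}" for u
  proof -
    consider "i + u \<in> band" | "M \<le> i + u" | "i + u < 0" by fastforce
    then show ?thesis
    proof cases
      case 1
      then show ?thesis by (auto simp: h_def intro!: has_sum_finiteI)
    next
      case 2
      then have "i + u \<in> {M..2*M-1}" using i u by auto
      from has_sum_infsum[OF above[OF this]]
      have "((\<lambda>us. p u * (x * path_weight p (\<lambda>_. x) (i + u) us)) has_sum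
          p u * (x * gf (\<lambda>_. x) (entries band j) (i + u))) (entries band j (i + u))"
        by (intro has_sum_cmult_right)
      then have "((\<lambda>us. path_weight p (split_value x y) i (u # us)) has_sum
          p u * (x * gf (\<lambda>_. x) (entries band j) (i + u))) (entries band j (i + u))"
        by (rule has_sum_cong[THEN iffD1, rotated])
          (use 2 i weight_above_entry[OF 2, of _ x y] in \<open>simp add: entries_def paths_def\<close>)
      moreover have "p u * (x * gf (\<lambda>_. x) (entries band j) (i + u)) = h (i + u)"
        using 2 i by (simp add: h_def)
      ultimately show ?thesis using 2 by simp
    next
      case 3
      then have "i + u \<in> {-M..-1}" using i u by auto
      from has_sum_infsum[OF below[OF this]]
      have "((\<lambda>us. p u * (x * path_weight p (\<lambda>_. y) (i + u) us)) has_sum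
          p u * (x * gf (\<lambda>_. y) (entries band j) (i + u))) (entries band j (i + u))"
        by (intro has_sum_cmult_right)
      then have "((\<lambda>us. path_weight p (split_value x y) i (u # us)) has_sum
          p u * (x * gf (\<lambda>_. y) (entries band j) (i + u))) (entries band j (i + u))"
        by (rule has_sum_cong[THEN iffD1, rotated])
          (use 3 weight_below_entry[OF 3, of _ y x] in \<open>simp add: entries_def paths_def\<close>)
      moreover have "p u * (x * gf (\<lambda>_. y) (entries band j) (i + u)) = h (i + u)"
        using 3 i by (simp add: h_def)
      ultimately show ?thesis using 3 by simp
    qed
  qed
  have "(path_weight p (split_value x y) i has_sum (\<Sum>u=-M..M. h (i + u))) (entries band j i)"
    unfolding entries_first_step[of band j i] by (intro has_sum_Cons_images step) auto
  moreover have "(\<Sum>u=-M..M. h (i + u)) = (\<Sum>k=-M..2*M-1. h k)"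
    using p_outside by (intro sum_over_steps[OF i]) (simp add: h_def)
  moreover have "(\<Sum>k=-M..2*M-1. h k) = (\<Sum>k=-M..-1. h k) + ((\<Sum>k\<in>band. h k) + (\<Sum>k=M..2*M-1. h k))"
  proof -
    have "{-M..2*M-1} = {-M..-1} \<union> (band \<union> {M..2*M-1})" using i by auto
    moreover have "{-M..-1} \<inter> (band \<union> {M..2*M-1}) = {}" "band \<inter> {M..2*M-1} = {}" by auto
    ultimately show ?thesis by (simp add: sum.union_disjoint)
  qed
  moreover have "(\<Sum>k=-M..-1. h k) = x * (\<Sum>k=-M..-1. p (k - i) * gf (\<lambda>_. y) (entries band j) k)"
    unfolding sum_distrib_left using i by (intro sum.cong) (auto simp: h_def)
  moreover have "(\<Sum>k=M..2*M-1. h k) = x * (\<Sum>k=M..2*M-1. p (k - i) * gf (\<lambda>_. x) (entries band j) k)"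
    unfolding sum_distrib_left by (intro sum.cong) (auto simp: h_def)
  moreover have "(\<Sum>k\<in>band. h k) = x * p (j - i)"
  proof -
    have "(\<Sum>k\<in>band. h k) = (\<Sum>k\<in>band. if k = j then x * p (j - i) else 0)"
      by (intro sum.cong) (auto simp: h_def)
    then show ?thesis using j by simp
  qed
  ultimately have *: "(path_weight p (split_value x y) i has_sum
      x * (p (j - i) + (\<Sum>k=M..2*M-1. p (k - i) * gf (\<lambda>_. x) (entries band j) k)
                     + (\<Sum>k=-M..-1. p (k - i) * gf (\<lambda>_. y) (entries band j) k))) (entries band j i)"
    by (simp add: algebra_simps)
  from * show "converges (split_value x y) (entries band j) i" by (rule has_sum_imp_summable)
  from * show "gf (split_value x y) (entries band j) i =
      x * (p (j - i) + (\<Sum>k=M..2*M-1. p (k - i) * gf (\<lambda>_. x) (entries band j) k)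
                     + (\<Sum>k=-M..-1. p (k - i) * gf (\<lambda>_. y) (entries band j) k))" by (rule infsumI)
qed

text \<open>
  The sites of the band carry the factor \<open>0\<close>.
\<close>
lemma gf_split_zero_avoiding:
  "gf (split_value 0 y) (paths F) i = gf (split_value 0 y) (avoiding band F) i"
  by (rule infsum_cong_neutral) (auto simp: avoiding_def intro: path_weight_kills_visit[of band])

text \<open>
  First passage at \<open>(x,y)\<close> and at \<open>(x,0)\<close> is combined with the value at \<open>(0,y)\<close>. The
  latter consists of paths avoiding the band only, hence contributes no product.
\<close>
lemma sojourn_gf_system:
  assumes i: "i \<in> band"
    and K: "\<And>j. j \<in> band \<Longrightarrow> converges (split_value x y) (paths F) j"
    and Kx: "\<And>j. j \<in> band \<Longrightarrow> converges (split_value x 0) (paths F) j"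
    and Ky: "converges (split_value 0 y) (paths F) i"
    and Hx: "\<And>j k. j \<in> band \<Longrightarrow> k \<in> {M..2*M-1} \<Longrightarrow> converges (\<lambda>_. x) (entries band j) k"
    and Hy: "\<And>j k. j \<in> band \<Longrightarrow> k \<in> {-M..-1} \<Longrightarrow> converges (\<lambda>_. y) (entries band j) k"
  shows "gf (split_value x y) (paths F) i =
      x * (\<Sum>j=0..M-1.
        (p (j - i) + (\<Sum>k=M..2*M-1. p (k - i) * gf (\<lambda>_. x) (entries band j) k)
                   + (\<Sum>k=-M..-1. p (k - i) * gf (\<lambda>_. y) (entries band j) k))
        * gf (split_value x y) (paths F) j)
      + gf (split_value x 0) (paths F) i + gf (split_value 0 y) (paths F) i - indicator F i
      - x * (\<Sum>j=0..M-1.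
        (p (j - i) + (\<Sum>k=M..2*M-1. p (k - i) * gf (\<lambda>_. x) (entries band j) k))
        * gf (split_value x 0) (paths F) j)"
proof -
  \<comment> \<open>At y = 0 the excursions below the band disappear: an entrance takes at least one step.\<close>
  have zero: "path_weight p (\<lambda>_. 0) k us = 0" if "us \<in> entries band j k" for j k us
    using that by (cases us) (auto simp: entries_def)
  have H0: "converges (\<lambda>_. 0) (entries band j) k" "gf (\<lambda>_. 0) (entries band j) k = 0" for j k
  proof -
    show "converges (\<lambda>_. 0) (entries band j) k"
      by (rule summable_on_cong[THEN iffD2, OF _ summable_on_0]) (auto simp: zero)
    show "gf (\<lambda>_. 0) (entries band j) k = 0"
      by (rule infsum_0) (auto simp: zero)
  qed
  have returns: "converges (split_value x y) (entries band j) i"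
      "gf (split_value x y) (entries band j) i =
        x * (p (j - i) + (\<Sum>k=M..2*M-1. p (k - i) * gf (\<lambda>_. x) (entries band j) k)
                       + (\<Sum>k=-M..-1. p (k - i) * gf (\<lambda>_. y) (entries band j) k))"
    if "j \<in> band" for j
    using return_gf[of i j x y] i that Hx Hy by blast+
  have returns0: "converges (split_value x 0) (entries band j) i"
      "gf (split_value x 0) (entries band j) i =
        x * (p (j - i) + (\<Sum>k=M..2*M-1. p (k - i) * gf (\<lambda>_. x) (entries band j) k))"
    if "j \<in> band" for j
    using return_gf[of i j x 0] i that Hx H0 by simp_all
  have eq: "gf (split_value x y) (paths F) i = gf (split_value x y) (avoiding band F) i +
      (\<Sum>j\<in>band. gf (split_value x y) (entries band j) i * gf (split_value x y) (paths F) j)"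
    by (rule first_passage) (auto intro!: K returns(1) i simp: enters_endpoint simp del: atLeastAtMost_iff)
  have eq0: "gf (split_value x 0) (paths F) i = gf (split_value x 0) (avoiding band F) i +
      (\<Sum>j\<in>band. gf (split_value x 0) (entries band j) i * gf (split_value x 0) (paths F) j)"
    by (rule first_passage) (auto intro!: Kx returns0(1) i simp: enters_endpoint simp del: atLeastAtMost_iff)
  have avoiding: "gf (split_value x y) (avoiding band F) i =
      gf (split_value x 0) (avoiding band F) i + gf (split_value 0 y) (avoiding band F) i - indicator F i"
  proof -
    \<comment> \<open>The empty word has weight 1 in both specialisations and must be counted once.\<close>
    let ?e = "\<lambda>us::int list. if us = [] then 1 else 0 :: real"
    have sx: "converges (split_value x 0) (avoiding band F) i"
      using Kx[OF i] by (rule summable_on_subset_banach) (auto simp: avoiding_def)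
    have sy: "converges (split_value 0 y) (avoiding band F) i"
      using Ky by (rule summable_on_subset_banach) (auto simp: avoiding_def)
    have e: "(?e has_sum indicator F i) (avoiding band F i)"
    proof (rule has_sum_finite_neutralI)
      show "finite (if i \<in> F then {[]} else {} :: int list set)" by simp
    qed (auto simp: avoiding_def paths_def split: if_splits)
    have "path_weight p (split_value x y) i us =
        path_weight p (split_value x 0) i us + path_weight p (split_value 0 y) i us - ?e us"
      if "us \<in> avoiding band F i" for us
    proof (cases us)
      case (Cons u vs)
      then have v: "avoids band (i + u) vs" "vs \<in> lists {-M..M}" and "i + u \<notin> band"
        using that by (auto simp: avoiding_def paths_def)
      then consider "M \<le> i + u" "0 \<le> i + u" | "i + u < 0" using i by fastforce
      then show ?thesis
      proof cases
        case 1
        then show ?thesis using Cons weight_above_avoiding[OF 1(1) v(2,1)] by simp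
      next
        case 2
        then show ?thesis using Cons weight_below_avoiding[OF 2 v(2,1)] by simp
      qed
    qed simp
    then have "gf (split_value x y) (avoiding band F) i = infsum (\<lambda>us.
        path_weight p (split_value x 0) i us + path_weight p (split_value 0 y) i us - ?e us) (avoiding band F i)"
      by (rule infsum_cong)
    also have "\<dots> = gf (split_value x 0) (avoiding band F) i + gf (split_value 0 y) (avoiding band F) i - indicator F i"
      using has_sum_add[OF has_sum_add[OF has_sum_infsum[OF sx] has_sum_infsum[OF sy]] has_sum_cmult_right[OF e, of "-1"]]
      by (intro infsumI) simp
    finally show ?thesis .
  qed
  have "(\<Sum>j\<in>band. gf (split_value x y) (entries band j) i * gf (split_value x y) (paths F) j) =
     x * (\<Sum>j=0..M-1.
        (p (j - i) + (\<Sum>k=M..2*M-1. p (k - i) * gf (\<lambda>_. x) (entries band j) k)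
                   + (\<Sum>k=-M..-1. p (k - i) * gf (\<lambda>_. y) (entries band j) k))
        * gf (split_value x y) (paths F) j)"
    unfolding sum_distrib_left by (intro sum.cong refl) (simp add: returns(2))
  moreover have "(\<Sum>j\<in>band. gf (split_value x 0) (entries band j) i * gf (split_value x 0) (paths F) j) =
     x * (\<Sum>j=0..M-1.
        (p (j - i) + (\<Sum>k=M..2*M-1. p (k - i) * gf (\<lambda>_. x) (entries band j) k))
        * gf (split_value x 0) (paths F) j)"
    unfolding sum_distrib_left by (intro sum.cong refl) (simp add: returns0(2))
  ultimately show ?thesis using eq eq0 avoiding gf_split_zero_avoiding[of y i F] by simp
qed

text \<open>
  Walks started at \<open>i\<close> and \<open>i + M\<close> with the same steps: as long as the first has not become
  negative the second is above the band, and the first negative site is at least \<open>-M\<close>.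
\<close>
lemma enters_negative_iff_enters_band:
  assumes "0 \<le> i" "us \<in> lists {-M..M}"
  shows "enters {..<0} i us \<longleftrightarrow> enters band (i + M) us"
  using assms
proof (induction us arbitrary: i)
  case (Cons u us)
  have u: "-M \<le> u" "u \<le> M" using Cons.prems by auto
  show ?case
  proof (cases "i + u < 0")
    case True
    then show ?thesis using u Cons.prems by auto
  next
    case False
    then show ?thesis using Cons.IH[of "i + u"] Cons.prems by (simp add: add_ac)
  qed
qed simp

text \<open>
  The value at \<open>(x,0)\<close> counts the paths without a negative site, which are all paths minus those
  that become negative. No step exceeds \<open>M\<close>, so the first negative site is one of
  \<open>-M, ..., -1\<close>; the shift by \<open>M\<close> moves these sites onto the band.
\<close>
lemma nonneg_gf:
  assumes i: "i \<in> band"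
    and G: "converges (\<lambda>_. x) (paths F) i"
    and H: "\<And>j. j \<in> band \<Longrightarrow> converges (\<lambda>_. x) (entries band j) (i + M)"
    and G': "\<And>j. j \<in> band \<Longrightarrow> converges (\<lambda>_. x) (paths F) (j - M)"
  shows "gf (split_value x 0) (paths F) i = gf (\<lambda>_. x) (paths F) i -
    (\<Sum>j=0..M-1. gf (\<lambda>_. x) (entries band j) (i + M) * gf (\<lambda>_. x) (paths F) (j - M))"
proof -
  have entr: "entries {..<0} (j - M) i = entries band j (i + M)" for j
    using i enters_negative_iff_enters_band[of i]
    by (auto simp: entries_def paths_def simp del: in_lists_conv_set)
  have shift: "path_weight p (\<lambda>_. x) i = path_weight p (\<lambda>_. x) (i + M)"
    by (rule ext) (rule path_weight_const_shift)
  have "gf (\<lambda>_. x) (paths F) i = gf (\<lambda>_. x) (avoiding {..<0} F) i +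
      (\<Sum>j\<in>{-M..-1}. gf (\<lambda>_. x) (entries {..<0} j) i * gf (\<lambda>_. x) (paths F) j)"
  proof (rule first_passage)
    fix us assume us: "us \<in> lists {-M..M}" "enters {..<0} i us"
    then have "enters band (i + M) us" using i enters_negative_iff_enters_band by auto
    then have "i + M + sum_list us \<in> band" by (rule enters_endpoint)
    then show "i + sum_list us \<in> {-M..-1}" by auto
  next
    fix j assume "j \<in> {-M..-1}"
    then have j: "j + M \<in> band" by auto
    show "converges (\<lambda>_. x) (entries {..<0} j) i"
      using H[OF j] entr[of "j + M"] shift by simp
    show "converges (\<lambda>_. x) (paths F) j" using G'[OF j] by simp
  qed (use G in auto)
  also have "(\<Sum>j\<in>{-M..-1}. gf (\<lambda>_. x) (entries {..<0} j) i * gf (\<lambda>_. x) (paths F) j) =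
      (\<Sum>j=0..M-1. gf (\<lambda>_. x) (entries band j) (i + M) * gf (\<lambda>_. x) (paths F) (j - M))"
    by (rule sum.reindex_bij_witness[of _ "\<lambda>j. j - M" "\<lambda>j. j + M"])
      (use entr[of "j + M" for j] shift in auto)
  also have "gf (\<lambda>_. x) (avoiding {..<0} F) i = gf (split_value x 0) (paths F) i"
  proof (rule infsum_cong_neutral)
    show "path_weight p (split_value x 0) i us = 0" if "us \<in> paths F i - avoiding {..<0} F i" for us
      using that by (intro path_weight_kills_visit[of "{..<0}"]) (auto simp: avoiding_def)
    show "path_weight p (\<lambda>_. x) i us = path_weight p (split_value x 0) i us"
      if "us \<in> avoiding {..<0} F i \<inter> paths F i" for us
      using that by (intro path_weight_cong_avoids[of "{..<0}"]) (auto simp: avoiding_def)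
  qed (auto simp: avoiding_def)
  finally show ?thesis by simp
qed

text \<open>
  Comparison of two first-step expansions, at \<open>(0,y)\<close> and at constant factor \<open>y\<close>. They differ
  by the steps to nonnegative sites and by the paths that step below the band and enter it later.
\<close>
lemma negative_gf:
  assumes i: "i \<in> band"
    and K: "converges (split_value 0 y) (paths F) i"
    and G: "\<And>j. j \<in> band \<Longrightarrow> converges (\<lambda>_. y) (paths F) j"
    and H: "\<And>j k. j \<in> band \<Longrightarrow> k \<in> {-M..-1} \<Longrightarrow> converges (\<lambda>_. y) (entries band j) k"
  shows "gf (split_value 0 y) (paths F) i = gf (\<lambda>_. y) (paths F) i
    - y * (\<Sum>j=0..2*M-1. p (j - i) * gf (\<lambda>_. y) (paths F) j)
    - y * (\<Sum>j=0..M-1. \<Sum>k=-M..-1.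
        p (k - i) * gf (\<lambda>_. y) (entries band j) k * gf (\<lambda>_. y) (paths F) j)"
proof -
  have range: "{-M..2*M-1} = {-M..-1} \<union> {0..2*M-1}" using i by auto
  have below: "p (k - i) * y * gf (\<lambda>_. y) (paths F) k =
      p (k - i) * y * gf (split_value 0 y) (paths F) k +
      y * (\<Sum>j=0..M-1. p (k - i) * gf (\<lambda>_. y) (entries band j) k * gf (\<lambda>_. y) (paths F) j)"
    if k: "k \<in> {-M..-1}" for k
  \<comment> \<open>The total weight from k may diverge, but then the coefficient p (k - i) * y is zero.\<close>
  proof (cases "p (k - i) * y = 0")
    case False
    have "gf (\<lambda>_. y) (paths F) k = gf (\<lambda>_. y) (avoiding band F) k +
        (\<Sum>j\<in>band. gf (\<lambda>_. y) (entries band j) k * gf (\<lambda>_. y) (paths F) j)"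
      by (rule first_passage)
        (use converges_paths_next[OF G[OF i] False] G H k in \<open>auto simp: enters_endpoint simp del: atLeastAtMost_iff\<close>)
    also have "gf (\<lambda>_. y) (avoiding band F) k = gf (split_value 0 y) (avoiding band F) k"
      using k by (intro infsum_cong weight_below_avoiding[symmetric]) (auto simp: avoiding_def paths_def)
    also have "\<dots> = gf (split_value 0 y) (paths F) k"
      by (rule gf_split_zero_avoiding[symmetric])
    finally show ?thesis
      by (simp add: algebra_simps sum_distrib_left)
  qed (auto simp: sum_distrib_left)
  have "gf (\<lambda>_. y) (paths F) i = indicator F i +
      (\<Sum>k=-M..-1. p (k - i) * y * gf (\<lambda>_. y) (paths F) k) +
      (\<Sum>k=0..2*M-1. p (k - i) * y * gf (\<lambda>_. y) (paths F) k)"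
    unfolding gf_paths_first_step[OF i G[OF i]] range by (subst sum.union_disjoint) auto
  moreover have "gf (split_value 0 y) (paths F) i = indicator F i +
      (\<Sum>k=-M..-1. p (k - i) * y * gf (split_value 0 y) (paths F) k)"
    unfolding gf_paths_first_step[OF i K] range by (subst sum.union_disjoint) auto
  moreover have "(\<Sum>k=-M..-1. p (k - i) * y * gf (\<lambda>_. y) (paths F) k) =
      (\<Sum>k=-M..-1. p (k - i) * y * gf (split_value 0 y) (paths F) k) +
      y * (\<Sum>j=0..M-1. \<Sum>k=-M..-1.
        p (k - i) * gf (\<lambda>_. y) (entries band j) k * gf (\<lambda>_. y) (paths F) j)"
    unfolding sum.swap[of _ "{-M..-1}" band] sum_distrib_left[of y _ "{-M..-1}"]
    by (simp add: below sum.distrib)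
  moreover have "(\<Sum>k=0..2*M-1. p (k - i) * y * gf (\<lambda>_. y) (paths F) k) =
      y * (\<Sum>j=0..2*M-1. p (j - i) * gf (\<lambda>_. y) (paths F) j)"
    by (simp add: sum_distrib_left mult_ac)
  ultimately show ?thesis by simp
qed

text \<open>
  No path from outside the band to a site of the band avoids the band, so the avoiding part of first
  passage is empty.
\<close>
lemma hitting_gf_system:
  assumes i: "i \<notin> band" and j: "j \<in> band"
    and H: "\<And>k. k \<in> band \<Longrightarrow> converges (\<lambda>_. x) (entries band k) i"
    and G: "\<And>k. k \<in> band \<Longrightarrow> converges (\<lambda>_. x) (paths {j}) k"
    and Gi: "converges (\<lambda>_. x) (paths {j}) i"
  shows "(\<Sum>k=0..M-1. gf (\<lambda>_. x) (entries band k) i * gf (\<lambda>_. x) (paths {j}) k) =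
    gf (\<lambda>_. x) (paths {j}) i"
proof -
  have end_outside: "i + sum_list us \<notin> band" if "i \<notin> band" "avoids band i us" for i us
    using that by (induction us arbitrary: i) (auto simp: add.assoc[symmetric])
  have "avoiding band {j} i = {}"
    using end_outside[OF i] j by (auto simp: avoiding_def paths_def)
  moreover have "gf (\<lambda>_. x) (paths {j}) i = gf (\<lambda>_. x) (avoiding band {j}) i +
      (\<Sum>k\<in>band. gf (\<lambda>_. x) (entries band k) i * gf (\<lambda>_. x) (paths {j}) k)"
    by (rule first_passage) (use H G Gi in \<open>auto simp: enters_endpoint simp del: atLeastAtMost_iff\<close>)
  ultimately show ?thesis by simp
qed

end

section \<open>From probabilities to weights of words\<close>

text \<open>
  The sojourn time of a word, by recursion on the first step so that induction on the word matches it
  with the exponents in \<open>path_weight\<close>.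
\<close>
primrec visits :: "int \<Rightarrow> int list \<Rightarrow> nat" where
  "visits i [] = 0"
| "visits i (u # us) = (if 0 \<le> i + u then 1 else 0) + visits (i + u) us"

lemma visits_snoc: "visits i (us @ [u]) = visits i us + (if 0 \<le> i + sum_list us + u then 1 else 0)"
  by (induction us arbitrary: i) (auto simp: add.assoc)

lemma visits_le_length: "visits i us \<le> length us"
  by (induction us arbitrary: i) (auto simp: le_SucI)

lemma avoids_snoc: "avoids C i (us @ [u]) \<longleftrightarrow> avoids C i us \<and> i + sum_list us + u \<notin> C"
  by (induction us arbitrary: i) (auto simp: add.assoc)

lemma enters_snoc: "enters C i (us @ [u]) \<longleftrightarrow> avoids C i us \<and> i + sum_list us + u \<in> C"
  by (induction us arbitrary: i) (auto simp: add.assoc)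

lemma path_weight_const: "path_weight p (\<lambda>_. x) i us = prod_list (map p us) * x ^ length us"
  by (induction us arbitrary: i) auto

lemma path_weight_split:
  "path_weight p (split_value x y) i us =
    prod_list (map p us) * (x ^ visits i us * y ^ (length us - visits i us))"
  by (induction us arbitrary: i) (auto simp: Suc_diff_le visits_le_length)

text \<open>
  A power series whose coefficients are finite sums of nonnegative weights is a sum over the weighted
  objects. Nonnegativity excludes cancellation inside a coefficient, so absolute convergence of the
  series suffices.
\<close>
lemma has_sum_graded:
  fixes w :: "'b \<Rightarrow> real" and z :: "'k \<Rightarrow> real"
  assumes w: "\<And>a. w a \<ge> 0"
    and fin: "\<And>k. finite {a \<in> A. g a = k}"
    and g: "g ` A \<subseteq> I"
    and conv: "(\<lambda>k. \<bar>(\<Sum>a | a \<in> A \<and> g a = k. w a) * z k\<bar>) summable_on I"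
  shows "((\<lambda>a. w a * z (g a)) has_sum (\<Sum>\<^sub>\<infinity>k\<in>I. (\<Sum>a | a \<in> A \<and> g a = k. w a) * z k)) A"
proof -
  let ?B = "\<lambda>k. {a \<in> A. g a = k}" and ?f = "\<lambda>(k, a). w a * z k"
  have "(\<lambda>q. norm (?f q)) summable_on Sigma I ?B"
    using fin by (intro summable_on_SigmaI[OF _ conv])
      (auto intro!: has_sum_finiteI simp: abs_mult sum_distrib_right[symmetric] sum_nonneg w)
  then have f: "?f summable_on Sigma I ?B" by (rule abs_summable_summable)
  have "(?f has_sum (\<Sum>\<^sub>\<infinity>k\<in>I. (\<Sum>a | a \<in> A \<and> g a = k. w a) * z k)) (Sigma I ?B)"
  proof (rule has_sum_SigmaI[OF _ has_sum_infsum f])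
    show "(\<lambda>k. (\<Sum>a | a \<in> A \<and> g a = k. w a) * z k) summable_on I"
      by (rule abs_summable_summable) (use conv in simp)
  qed (use fin in \<open>auto intro!: has_sum_finiteI simp: sum_distrib_right\<close>)
  moreover have "bij_betw (\<lambda>a. (g a, a)) A (Sigma I ?B)"
    using g by (auto simp: bij_betw_def inj_on_def image_iff)
  ultimately show ?thesis
    by (subst (asm) has_sum_reindex_bij_betw[symmetric]) auto
qed

context LR_walk
begin

section \<open>The law of the random word\<close>

abbreviation step_law :: "int \<Rightarrow> real" where
  "step_law \<equiv> step_prob P L R U"

sublocale steps: bounded_steps step_law "max L R"
  by unfold_locales (auto simp: step_prob_def)

definition word :: "nat \<Rightarrow> 'a \<Rightarrow> int list" where
  "word n \<omega> = map (\<lambda>l. U l \<omega>) [1..<Suc n]"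

lemma word_0: "word 0 \<omega> = []"
  by (simp add: word_def)

lemma word_Suc: "word (Suc n) \<omega> = word n \<omega> @ [U (Suc n) \<omega>]"
  by (simp add: word_def)

lemma length_word: "length (word n \<omega>) = n"
  by (simp add: word_def)

lemma word_in_lists:
  assumes "\<omega> \<in> space P"
  shows "word n \<omega> \<in> lists {-max L R..max L R}"
proof -
  have "U l \<omega> \<in> {-max L R..max L R}" if "l \<ge> 1" for l
    using steps_range[OF that assms] by auto
  then show ?thesis by (auto simp: word_def)
qed

lemma walk_word: "walk U i n \<omega> = i + sum_list (word n \<omega>)"
  by (induction n) (simp_all add: walk_def word_0 word_Suc)

lemma walk_Suc: "walk U i (Suc n) \<omega> = i + sum_list (word n \<omega>) + U (Suc n) \<omega>"
  by (simp add: walk_word word_Suc)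

lemma sojourn_word: "sojourn U i n \<omega> = visits i (word n \<omega>)"
proof (induction n)
  case (Suc n)
  have "{m \<in> {1..Suc n}. walk U i m \<omega> \<ge> 0} =
      {m \<in> {1..n}. walk U i m \<omega> \<ge> 0} \<union> (if walk U i (Suc n) \<omega> \<ge> 0 then {Suc n} else {})"
    by (auto simp: le_Suc_eq)
  then show ?case using Suc
    by (simp add: sojourn_def word_Suc visits_snoc walk_Suc del: One_nat_def)
qed (simp add: sojourn_def word_0)

lemma avoids_word: "avoids C i (word n \<omega>) \<longleftrightarrow> (\<forall>m\<in>{1..n}. walk U i m \<omega> \<notin> C)"
proof (induction n)
  case (Suc n)
  have "{1..Suc n} = insert (Suc n) {1..n}" by auto
  then show ?case using Suc by (auto simp: word_Suc avoids_snoc walk_Suc)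
qed (simp add: word_0)

lemma enters_word:
  "enters C i (word n \<omega>) \<longleftrightarrow> 1 \<le> n \<and> walk U i n \<omega> \<in> C \<and> (\<forall>m\<in>{1..<n}. walk U i m \<omega> \<notin> C)"
proof (cases n)
  case (Suc k)
  have "{1..<Suc k} = {1..k}" by auto
  then show ?thesis using Suc by (auto simp: word_Suc enters_snoc avoids_word walk_Suc)
qed (simp add: word_0)

lemma hit_time_enters:
  assumes "enters {0..M-1} i (word m \<omega>)"
  shows "hit_time U M i \<omega> = enat m"
  unfolding hit_time_def
proof (rule antisym)
  show "(INF m \<in> {m. m \<ge> 1 \<and> walk U i m \<omega> \<in> {0..M-1}}. enat m) \<le> enat m"
    using assms by (intro INF_lower) (auto simp: enters_word)
  show "enat m \<le> (INF m \<in> {m. m \<ge> 1 \<and> walk U i m \<omega> \<in> {0..M-1}}. enat m)"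
  proof (rule INF_greatest)
    fix n assume "n \<in> {m. m \<ge> 1 \<and> walk U i m \<omega> \<in> {0..M-1}}"
    then show "enat m \<le> enat n"
      using assms by (auto simp: enters_word not_less[symmetric] simp del: not_less)
  qed
qed

lemma hit_time_infinite:
  assumes "\<And>m. \<not> enters {0..M-1} i (word m \<omega>)"
  shows "hit_time U M i \<omega> = \<infinity>"
proof -
  have "walk U i n \<omega> \<notin> {0..M-1}" if "n \<ge> 1" for n
    using that
  proof (induction n rule: less_induct)
    case (less n)
    then show ?case using assms[of n] by (auto simp: enters_word)
  qed
  then have "{m. m \<ge> 1 \<and> walk U i m \<omega> \<in> {0..M-1}} = {}" by blast
  then show ?thesis unfolding hit_time_def by (simp only: image_empty Inf_enat_def) simp
qed

lemma random_step: "l \<ge> 1 \<Longrightarrow> U l \<in> measurable P (count_space UNIV)"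
  using steps_indep by (simp add: indep_vars_def2)

lemma prob_step:
  assumes "l \<ge> 1"
  shows "prob (U l -` {k} \<inter> space P) = step_law k"
proof -
  have "prob (U l -` {k} \<inter> space P) = measure (distr P (count_space UNIV) (U l)) {k}"
    using random_step[OF assms] by (simp add: measure_distr)
  also have "\<dots> = measure (distr P (count_space UNIV) (U 1)) {k}"
    using steps_ident[OF assms] by simp
  also have "\<dots> = prob (U 1 -` {k} \<inter> space P)"
    using random_step[of 1] by (simp add: measure_distr)
  also have "U 1 -` {k} \<inter> space P = {\<omega> \<in> space P. U 1 \<omega> = k}" by auto
  also have "prob \<dots> = step_law k"
  proof (cases "k \<in> {-L..R}")
    case False
    then have "{\<omega> \<in> space P. U 1 \<omega> = k} = {}" using steps_range[of 1] by auto
    then have "prob {\<omega> \<in> space P. U 1 \<omega> = k} = 0" by (simp only: measure_empty)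
    then show ?thesis using False by (simp add: step_prob_def)
  qed (simp add: step_prob_def)
  finally show ?thesis .
qed

lemma word_eq_event:
  assumes "length us = n"
  shows "{\<omega> \<in> space P. word n \<omega> = us} = (\<Inter>l\<in>{1..n}. U l -` {us ! (l - 1)} \<inter> space P) \<inter> space P"
proof -
  have "word n \<omega> = us \<longleftrightarrow> (\<forall>l\<in>{1..n}. U l \<omega> = us ! (l - 1))" for \<omega>
  proof -
    have "word n \<omega> = us \<longleftrightarrow> (\<forall>k<n. U (Suc k) \<omega> = us ! k)"
      using assms by (auto simp: list_eq_iff_nth_eq word_def simp del: upt_Suc)
    also have "\<dots> \<longleftrightarrow> (\<forall>l\<in>{1..n}. U l \<omega> = us ! (l - 1))"
      unfolding image_Suc_lessThan[symmetric] by auto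
    finally show ?thesis .
  qed
  then show ?thesis by auto
qed

lemma word_eq_measurable: "{\<omega> \<in> space P. word n \<omega> = us} \<in> events"
proof (cases "length us = n")
  case True
  have "(\<Inter>l\<in>{1..n}. U l -` {us ! (l - 1)} \<inter> space P) \<inter> space P \<in> events"
  proof (cases "n = 0")
    case False
    have "U l -` {us ! (l - 1)} \<inter> space P \<in> events" if "l \<in> {1..n}" for l
      using that by (intro measurable_sets[OF random_step]) auto
    then have "(\<Inter>l\<in>{1..n}. U l -` {us ! (l - 1)} \<inter> space P) \<in> events"
      using False by (intro sets.finite_INT) (simp_all only: finite_atLeastAtMost, simp)
    then show ?thesis by (rule sets.Int) simp
  qed simp
  then show ?thesis unfolding word_eq_event[OF True] .
next
  case False
  then have "{\<omega> \<in> space P. word n \<omega> = us} = {}" using length_word by auto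
  then show ?thesis by (metis sets.empty_sets)
qed

text \<open>
  Independence splits the event into single steps; equal distribution, through \<open>prob_step\<close>, gives
  them all the same law.
\<close>
lemma prob_word_eq:
  assumes "length us = n"
  shows "prob {\<omega> \<in> space P. word n \<omega> = us} = prod_list (map step_law us)"
proof (cases "n = 0")
  case True
  then show ?thesis using assms by (simp add: word_0 prob_space)
next
  case False
  then have "(\<Inter>l\<in>{1..n}. U l -` {us ! (l - 1)} \<inter> space P) \<inter> space P =
      (\<Inter>l\<in>{1..n}. U l -` {us ! (l - 1)} \<inter> space P)" by fastforce
  then have "prob {\<omega> \<in> space P. word n \<omega> = us} = prob (\<Inter>l\<in>{1..n}. U l -` {us ! (l - 1)} \<inter> space P)"
    unfolding word_eq_event[OF assms] by simp
  also have "\<dots> = (\<Prod>l\<in>{1..n}. prob (U l -` {us ! (l - 1)} \<inter> space P))"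
    using False by (intro indep_varsD[OF steps_indep]) auto
  also have "\<dots> = (\<Prod>l\<in>{1..n}. step_law (us ! (l - 1)))"
    by (intro prod.cong prob_step) auto
  also have "\<dots> = (\<Prod>k<n. step_law (us ! k))"
    by (rule prod.reindex_bij_witness[of _ Suc "\<lambda>l. l - 1"]) auto
  also have "\<dots> = prod_list (map step_law us)"
    using assms by (simp add: prod.list_conv_set_nth lessThan_atLeast0)
  finally show ?thesis .
qed

lemma word_pred_event:
  "{\<omega> \<in> space P. Q (word n \<omega>)} =
    (\<Union>us\<in>{us \<in> lists {-max L R..max L R}. Q us \<and> length us = n}. {\<omega> \<in> space P. word n \<omega> = us})"
  using word_in_lists length_word by auto

lemma finite_words: "finite {us \<in> lists {-max L R..max L R}. Q us \<and> length us = n}"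
proof (rule finite_subset)
  show "finite {us. set us \<subseteq> {-max L R..max L R} \<and> length us = n}"
    by (rule finite_lists_length_eq) simp
qed auto

lemma word_pred_measurable: "{\<omega> \<in> space P. Q (word n \<omega>)} \<in> events"
  unfolding word_pred_event using word_eq_measurable by (intro sets.finite_UN finite_words) auto

lemma prob_word_pred:
  "\<P>(\<omega> in P. Q (word n \<omega>)) =
    (\<Sum>us | us \<in> lists {-max L R..max L R} \<and> Q us \<and> length us = n. prod_list (map step_law us))"
proof -
  have "prob {\<omega> \<in> space P. Q (word n \<omega>)} =
      (\<Sum>us | us \<in> lists {-max L R..max L R} \<and> Q us \<and> length us = n. prob {\<omega> \<in> space P. word n \<omega> = us})"
    unfolding word_pred_event using word_eq_measurable
    by (intro finite_measure_finite_Union finite_words) (auto simp: disjoint_family_on_def)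
  also have "\<dots> = (\<Sum>us | us \<in> lists {-max L R..max L R} \<and> Q us \<and> length us = n. prod_list (map step_law us))"
    by (intro sum.cong prob_word_eq) auto
  finally show ?thesis .
qed

lemma weight_nonneg: "prod_list (map step_law us) \<ge> 0"
  by (induction us) (auto simp: step_prob_def)

section \<open>Generating functions as weights of languages\<close>

text \<open>
  The common form of the transfer for \<open>G\<close> and \<open>H\<close>, which mark time only.
\<close>
lemma has_sum_by_length:
  assumes A: "\<And>n. prob {\<omega> \<in> space P. word n \<omega> \<in> A} = c n" "A \<subseteq> lists {-max L R..max L R}"
    and conv: "summable (\<lambda>n. \<bar>c n * x ^ n\<bar>)"
  shows "(path_weight step_law (\<lambda>_. x) i has_sum (\<Sum>n. c n * x ^ n)) A"
proof -
  have c: "c n = (\<Sum>us | us \<in> A \<and> length us = n. prod_list (map step_law us))" for n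
  proof -
    have "{us. us \<in> lists {-max L R..max L R} \<and> us \<in> A \<and> length us = n} = {us. us \<in> A \<and> length us = n}"
      using A(2) by auto
    then show ?thesis using A(1)[of n] prob_word_pred[of "\<lambda>us. us \<in> A" n] by simp
  qed
  have conv': "(\<lambda>n. \<bar>c n * x ^ n\<bar>) summable_on UNIV"
    using conv by (subst summable_on_UNIV_nonneg_real_iff) auto
  have "((\<lambda>us. prod_list (map step_law us) * x ^ length us) has_sum
      (\<Sum>\<^sub>\<infinity>n. (\<Sum>us | us \<in> A \<and> length us = n. prod_list (map step_law us)) * x ^ n)) A"
  proof (rule has_sum_graded)
    show "finite {us \<in> A. length us = n}" for n
      using A(2) by (intro finite_subset[OF _ finite_words[of "\<lambda>_. True" n]]) auto
  qed (use weight_nonneg conv' in \<open>simp_all add: c\<close>)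
  moreover have "(\<Sum>\<^sub>\<infinity>n. c n * x ^ n) = (\<Sum>n. c n * x ^ n)"
  proof -
    have "(\<lambda>n. c n * x ^ n) summable_on UNIV"
      by (rule abs_summable_summable) (use conv' in simp)
    then show ?thesis by (metis has_sum_imp_sums has_sum_infsum sums_unique)
  qed
  ultimately show ?thesis unfolding path_weight_const c[symmetric] by simp
qed

lemma GF_has_sum:
  assumes "GF_conv P U F i x"
  shows "(path_weight step_law (\<lambda>_. x) i has_sum GF_fun P U F i x) (steps.paths F i)"
  unfolding GF_fun_def GF_term_def
proof (rule has_sum_by_length)
  show "prob {\<omega> \<in> space P. word n \<omega> \<in> steps.paths F i} = \<P>(\<omega> in P. walk U i n \<omega> \<in> F)" for n
    using word_in_lists
    by (intro arg_cong[of _ _ prob] Collect_cong conj_cong refl) (simp add: steps.paths_def walk_word del: in_lists_conv_set)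
qed (use assms in \<open>auto simp: steps.paths_def GF_conv_def GF_term_def\<close>)

lemma G_has_sum:
  assumes "G_conv P U i j x"
  shows "(path_weight step_law (\<lambda>_. x) i has_sum G_fun P U i j x) (steps.paths {j} i)"
  using GF_has_sum[of "{j}" i x] assms
  by (simp add: GF_conv_def GF_fun_def GF_term_def G_conv_def G_fun_def G_term_def)

lemma K_has_sum:
  assumes "K_conv P U F i x y"
  shows "(path_weight step_law (split_value x y) i has_sum K_fun P U F i x y) (steps.paths F i)"
proof -
  let ?z = "\<lambda>(m, n). x ^ m * y ^ (n - m)" and ?g = "\<lambda>us. (visits i us, length us)"
  let ?w = "\<lambda>us. prod_list (map step_law us)"
  have K: "K_term P U F i x y q = (\<Sum>us | us \<in> steps.paths F i \<and> ?g us = q. ?w us) * ?z q" for q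
  proof (cases q)
    case (Pair m n)
    have "\<P>(\<omega> in P. sojourn U i n \<omega> = m \<and> walk U i n \<omega> \<in> F) =
        \<P>(\<omega> in P. visits i (word n \<omega>) = m \<and> i + sum_list (word n \<omega>) \<in> F)"
      by (simp add: sojourn_word walk_word)
    also have "\<dots> = (\<Sum>us | us \<in> lists {-max L R..max L R} \<and>
        (visits i us = m \<and> i + sum_list us \<in> F) \<and> length us = n. ?w us)"
      by (rule prob_word_pred)
    also have "{us. us \<in> lists {-max L R..max L R} \<and>
        (visits i us = m \<and> i + sum_list us \<in> F) \<and> length us = n} =
        {us. us \<in> steps.paths F i \<and> ?g us = q}"
      by (auto simp: steps.paths_def Pair)
    finally show ?thesis by (simp add: K_term_def Pair)
  qed
  have "((\<lambda>us. ?w us * ?z (?g us)) has_sum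
      (\<Sum>\<^sub>\<infinity>q\<in>{(m, n). m \<le> n}. (\<Sum>us | us \<in> steps.paths F i \<and> ?g us = q. ?w us) * ?z q)) (steps.paths F i)"
  proof (rule has_sum_graded)
    show "finite {us \<in> steps.paths F i. ?g us = q}" for q
      by (rule finite_subset[OF _ finite_words[of "\<lambda>_. True" "snd q"]]) (auto simp: steps.paths_def)
    show "?g ` steps.paths F i \<subseteq> {(m, n). m \<le> n}"
      by (auto simp: visits_le_length)
    show "(\<lambda>q. \<bar>(\<Sum>us | us \<in> steps.paths F i \<and> ?g us = q. ?w us) * ?z q\<bar>) summable_on {(m, n). m \<le> n}"
      using assms unfolding K_conv_def K .
  qed (rule weight_nonneg)
  moreover have "path_weight step_law (split_value x y) i = (\<lambda>us. ?w us * ?z (?g us))"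
    by (rule ext) (simp add: path_weight_split)
  ultimately show ?thesis unfolding K_fun_def K by simp
qed

text \<open>
  The hitting time is the length of the only entrance word among the initial pieces of the walk, so
  at each outcome the series has at most one nonzero term.
\<close>
lemma H_term_sums:
  "(\<lambda>m. x ^ m * indicator {\<omega> \<in> space P. enters {0..M-1} i (word m \<omega>) \<and> walk U i m \<omega> = j} \<omega>)
    sums H_term U M i j x \<omega>" (is "(\<lambda>m. ?f m) sums _")
  if \<omega>: "\<omega> \<in> space P"
proof (cases "\<exists>m. enters {0..M-1} i (word m \<omega>)")
  case True
  then obtain m where m: "enters {0..M-1} i (word m \<omega>)" by blast
  define f where "f = ?f"
  have "f n = 0" if "n \<noteq> m" for n
    using hit_time_enters[OF m] hit_time_enters[of M i n \<omega>] that by (auto simp: f_def indicator_def)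
  then have "f sums f m" using sums_finite[of "{m}" f] by simp
  moreover have "f m = H_term U M i j x \<omega>"
    using m \<omega> by (simp add: f_def H_term_def hit_time_enters[OF m] indicator_def)
  ultimately show ?thesis by (simp add: f_def)
next
  case False
  then have "?f = (\<lambda>_. 0)" by (auto simp: indicator_def)
  moreover have "H_term U M i j x \<omega> = 0"
    using False hit_time_infinite[of M i \<omega>] by (simp add: H_term_def)
  ultimately show ?thesis by simp
qed

text \<open>
  Integrability bounds the partial sums of the coefficient series, since these are expectations of
  variables dominated by the absolute value of the integrand. Hence the expectation may be computed
  term by term.
\<close>
lemma H_has_sum:
  assumes "H_conv P U (max L R) i j x"
  shows "(path_weight step_law (\<lambda>_. x) i has_sum H_fun P U (max L R) i j x)
    (steps.entries {0..max L R-1} j i)"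
proof -
  let ?M = "max L R"
  define E where "E m = {\<omega> \<in> space P. enters {0..?M-1} i (word m \<omega>) \<and> walk U i m \<omega> = j}" for m
  have E: "E m \<in> events" for m
    unfolding E_def walk_word by (rule word_pred_measurable)
  have int_E: "integrable P (indicat_real (E m))" for m
    using E by (simp add: less_top[symmetric])
  have sums: "(\<lambda>m. x ^ m * indicator (E m) \<omega>) sums H_term U ?M i j x \<omega>" if "\<omega> \<in> space P" for \<omega>
    unfolding E_def using H_term_sums[OF that] .
  have unique: "m = n" if "\<omega> \<in> E m" "\<omega> \<in> E n" for m n \<omega>
    using that hit_time_enters[of ?M i m \<omega>] hit_time_enters[of ?M i n \<omega>] by (auto simp: E_def)
  have partial: "(\<Sum>m<N. \<bar>x\<bar> ^ m * indicator (E m) \<omega>) \<le> \<bar>H_term U ?M i j x \<omega>\<bar>"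
    if \<omega>: "\<omega> \<in> space P" for N \<omega>
  proof (cases "\<exists>m<N. \<omega> \<in> E m")
    case True
    then obtain m where m: "m < N" "\<omega> \<in> E m" by blast
    have "(\<Sum>n<N. \<bar>x\<bar> ^ n * indicator (E n) \<omega>) = (\<Sum>n<N. if n = m then \<bar>x\<bar> ^ m else 0)"
      using m unique by (intro sum.cong) (auto simp: indicator_def)
    also have "\<dots> = \<bar>x\<bar> ^ m" using m by simp
    also have "\<dots> = \<bar>H_term U ?M i j x \<omega>\<bar>"
      using m hit_time_enters[of ?M i m \<omega>] by (simp add: H_term_def E_def power_abs)
    finally show ?thesis by simp
  next
    case False
    then have "(\<Sum>n<N. \<bar>x\<bar> ^ n * indicator (E n) \<omega>) = 0" by (intro sum.neutral) auto
    then show ?thesis by simp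
  qed
  have int: "integrable P (H_term U ?M i j x)"
    using assms by (simp add: H_conv_def)
  have conv: "summable (\<lambda>m. \<bar>x\<bar> ^ m * prob (E m))"
  proof (rule summableI_nonneg_bounded)
    fix N
    have "(\<Sum>m<N. \<bar>x\<bar> ^ m * prob (E m)) = (\<Sum>m<N. LINT \<omega>|P. \<bar>x\<bar> ^ m * indicator (E m) \<omega>)"
      using E by simp
    also have "\<dots> = (LINT \<omega>|P. (\<Sum>m<N. \<bar>x\<bar> ^ m * indicator (E m) \<omega>))"
      using E by (intro Bochner_Integration.integral_sum[symmetric]) (simp add: int_E)
    also have "\<dots> \<le> (LINT \<omega>|P. \<bar>H_term U ?M i j x \<omega>\<bar>)"
    proof (rule integral_mono)
      show "integrable P (\<lambda>\<omega>. \<Sum>m<N. \<bar>x\<bar> ^ m * indicator (E m) \<omega>)"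
        using int_E by (intro Bochner_Integration.integrable_sum integrable_mult_right)
    qed (use int partial in auto)
    finally show "(\<Sum>m<N. \<bar>x\<bar> ^ m * prob (E m)) \<le> (LINT \<omega>|P. \<bar>H_term U ?M i j x \<omega>\<bar>)" .
  qed auto
  have "(\<lambda>m. LINT \<omega>|P. x ^ m * indicator (E m) \<omega>) sums
      (LINT \<omega>|P. (\<Sum>m. x ^ m * indicator (E m) \<omega>))"
  proof (rule sums_integral)
    show "integrable P (\<lambda>\<omega>. x ^ m * indicator (E m) \<omega>)" for m using int_E by simp
    show "AE \<omega> in P. summable (\<lambda>m. norm (x ^ m * indicator (E m) \<omega>))"
    proof (rule AE_I2)
      fix \<omega> assume "\<omega> \<in> space P"
      then show "summable (\<lambda>m. norm (x ^ m * indicator (E m) \<omega>))"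
        using partial by (intro summableI_nonneg_bounded[where x = "\<bar>H_term U ?M i j x \<omega>\<bar>"])
          (auto simp: abs_mult power_abs)
    qed
    show "summable (\<lambda>m. LINT \<omega>|P. norm (x ^ m * indicator (E m) \<omega>))"
      using conv E by (simp add: abs_mult power_abs)
  qed
  also have "(LINT \<omega>|P. (\<Sum>m. x ^ m * indicator (E m) \<omega>)) = H_fun P U ?M i j x"
    unfolding H_fun_def by (intro Bochner_Integration.integral_cong refl sums_unique[symmetric] sums)
  finally have expectation: "(\<Sum>m. prob (E m) * x ^ m) = H_fun P U ?M i j x"
    using E by (simp add: sums_iff mult.commute)
  have "(path_weight step_law (\<lambda>_. x) i has_sum (\<Sum>m. prob (E m) * x ^ m)) (steps.entries {0..?M-1} j i)"
  proof (rule has_sum_by_length)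
    show "prob {\<omega> \<in> space P. word n \<omega> \<in> steps.entries {0..?M-1} j i} = prob (E n)" for n
      unfolding E_def using word_in_lists
      by (intro arg_cong[of _ _ prob] Collect_cong conj_cong refl)
        (auto simp: steps.entries_def steps.paths_def walk_word simp del: in_lists_conv_set)
    show "summable (\<lambda>n. \<bar>prob (E n) * x ^ n\<bar>)"
      using conv by (simp add: abs_mult power_abs mult.commute)
  qed (auto simp: steps.entries_def steps.paths_def)
  then show ?thesis unfolding expectation .
qed

section \<open>Convergence inside the unit disc\<close>

lemma GF_conv_inside: "\<bar>x\<bar> < 1 \<Longrightarrow> GF_conv P U F i x"
  unfolding GF_conv_def GF_term_def
  by (rule summable_comparison_test[of _ "\<lambda>m. \<bar>x\<bar> ^ m"])
    (auto simp: abs_mult power_abs mult_left_le_one_le)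

lemma G_conv_inside: "\<bar>x\<bar> < 1 \<Longrightarrow> G_conv P U i j x"
  using GF_conv_inside[of x "{j}" i] by (simp add: GF_conv_def GF_term_def G_conv_def G_term_def)

text \<open>
  The integrand is bounded by \<open>1\<close>; measurability comes from its series expansion.
\<close>
lemma H_conv_inside:
  assumes "\<bar>x\<bar> < 1"
  shows "H_conv P U M i j x"
  unfolding H_conv_def
proof (rule integrable_const_bound)
  show "AE \<omega> in P. norm (H_term U M i j x \<omega>) \<le> 1"
    using assms by (auto simp: H_term_def indicator_def power_abs power_le_one)
  have "{\<omega> \<in> space P. enters {0..M-1} i (word m \<omega>) \<and> walk U i m \<omega> = j} \<in> events" for m
    unfolding walk_word by (rule word_pred_measurable)
  then have "(\<lambda>\<omega>. \<Sum>m. x ^ m * indicator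
      {\<omega> \<in> space P. enters {0..M-1} i (word m \<omega>) \<and> walk U i m \<omega> = j} \<omega>) \<in> borel_measurable P"
    by measurable
  then show "H_term U M i j x \<in> borel_measurable P"
    by (rule measurable_cong[THEN iffD1, rotated]) (rule sums_unique[OF H_term_sums, symmetric])
qed

text \<open>
  In the variables \<open>m\<close> and \<open>n - m\<close> the terms are dominated by a product of geometric series.
\<close>
lemma K_conv_inside:
  assumes "\<bar>x\<bar> < 1" "\<bar>y\<bar> < 1"
  shows "K_conv P U F i x y"
proof -
  have "(\<lambda>m. \<bar>z\<bar> ^ m) summable_on (UNIV :: nat set)" if "\<bar>z\<bar> < 1" for z :: real
    using that by (subst summable_on_UNIV_nonneg_real_iff) auto
  from has_sum_times[OF this[OF assms(1), THEN has_sum_infsum] this[OF assms(2), THEN has_sum_infsum]]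
  have "(\<lambda>(a, b). \<bar>x\<bar> ^ a * \<bar>y\<bar> ^ b) summable_on (UNIV :: (nat \<times> nat) set)"
    by (auto dest: has_sum_imp_summable)
  moreover have "bij_betw (\<lambda>(m, n). (m, n - m)) {(m, n). m \<le> n} (UNIV :: (nat \<times> nat) set)"
    by (rule bij_betw_byWitness[where f' = "\<lambda>(a, b). (a, a + b)"]) auto
  ultimately have "(\<lambda>(m, n). \<bar>x\<bar> ^ m * \<bar>y\<bar> ^ (n - m)) summable_on {(m, n). m \<le> n}"
    by (subst (asm) summable_on_reindex_bij_betw[symmetric]) (auto simp: case_prod_unfold)
  then show ?thesis unfolding K_conv_def
    by (rule summable_on_comparison_test)
      (auto simp: K_term_def abs_mult power_abs mult.assoc intro!: mult_left_le_one_le)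
qed

end


section \<open>The system of generating functions\<close>

theorem theorem4p1:
  fixes P :: "'a measure" and L R M :: int and U :: "nat \<Rightarrow> 'a \<Rightarrow> int"
    and F :: "int set" and x y :: real
  assumes walk: "LR_walk P L R U"
    and M: "M = max L R"
  shows
    "(\<bar>x\<bar> < 1 \<longrightarrow> (\<forall>i j. G_conv P U i j x \<and> GF_conv P U F i x \<and> H_conv P U M i j x)) \<and>
     (\<bar>x\<bar> < 1 \<and> \<bar>y\<bar> < 1 \<longrightarrow> (\<forall>i. K_conv P U F i x y)) \<and>
     (\<forall>i\<in>{0..M-1}.
        (\<forall>j\<in>{0..M-1}. K_conv P U F j x y \<and> K_conv P U F j x 0 \<and>
           (\<forall>k\<in>{M..2*M-1}. H_conv P U M k j x) \<and> (\<forall>k\<in>{-M..-1}. H_conv P U M k j y)) \<and>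
        K_conv P U F i 0 y \<longrightarrow>
        K_fun P U F i x y =
          x * (\<Sum>j=0..M-1.
                (trans_prob P L R U i j
                 + (\<Sum>k=M..2*M-1. trans_prob P L R U i k * H_fun P U M k j x)
                 + (\<Sum>k=-M..-1. trans_prob P L R U i k * H_fun P U M k j y))
                * K_fun P U F j x y)
          + K_fun P U F i x 0 + K_fun P U F i 0 y - indicator F i
          - x * (\<Sum>j=0..M-1.
                (trans_prob P L R U i j
                 + (\<Sum>k=M..2*M-1. trans_prob P L R U i k * H_fun P U M k j x))
                * K_fun P U F j x 0)) \<and>
     (\<forall>i\<in>{0..M-1}.
        K_conv P U F i x 0 \<and> GF_conv P U F i x \<and>
        (\<forall>j\<in>{0..M-1}. H_conv P U M (i + M) j x \<and> GF_conv P U F (j - M) x) \<longrightarrow>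
        K_fun P U F i x 0 =
          GF_fun P U F i x - (\<Sum>j=0..M-1. H_fun P U M (i + M) j x * GF_fun P U F (j - M) x)) \<and>
     (\<forall>i\<in>{0..M-1}.
        K_conv P U F i 0 y \<and> (\<forall>j\<in>{0..2*M-1}. GF_conv P U F j y) \<and>
        (\<forall>j\<in>{0..M-1}. \<forall>k\<in>{-M..-1}. H_conv P U M k j y) \<longrightarrow>
        K_fun P U F i 0 y =
          GF_fun P U F i y - y * (\<Sum>j=0..2*M-1. trans_prob P L R U i j * GF_fun P U F j y)
          - y * (\<Sum>j=0..M-1. \<Sum>k=-M..-1.
                   trans_prob P L R U i k * H_fun P U M k j y * GF_fun P U F j y)) \<and>
     (\<forall>i\<in>{M..2*M-1}. \<forall>j\<in>{0..M-1}.
        (\<forall>k\<in>{0..M-1}. H_conv P U M i k x \<and> G_conv P U k j x) \<and> G_conv P U i j x \<longrightarrow>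
        (\<Sum>k=0..M-1. H_fun P U M i k x * G_fun P U k j x) = G_fun P U i j x) \<and>
     (\<forall>i\<in>{-M..-1}. \<forall>j\<in>{0..M-1}.
        (\<forall>k\<in>{0..M-1}. H_conv P U M i k y \<and> G_conv P U k j y) \<and> G_conv P U i j y \<longrightarrow>
        (\<Sum>k=0..M-1. H_fun P U M i k y * G_fun P U k j y) = G_fun P U i j y)"
proof -
  interpret LR_walk P L R U by (rule walk)
  have G: "path_weight step_law (\<lambda>_. z) i summable_on steps.paths {j} i"
    "infsum (path_weight step_law (\<lambda>_. z) i) (steps.paths {j} i) = G_fun P U i j z"
    if "G_conv P U i j z" for i j z
    using G_has_sum[OF that] by (auto dest: has_sum_imp_summable infsumI)
  have GF: "path_weight step_law (\<lambda>_. z) i summable_on steps.paths F i"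
    "infsum (path_weight step_law (\<lambda>_. z) i) (steps.paths F i) = GF_fun P U F i z"
    if "GF_conv P U F i z" for i z
    using GF_has_sum[OF that] by (auto dest: has_sum_imp_summable infsumI)
  have H: "path_weight step_law (\<lambda>_. z) i summable_on steps.entries {0..M-1} j i"
    "infsum (path_weight step_law (\<lambda>_. z) i) (steps.entries {0..M-1} j i) = H_fun P U M i j z"
    if "H_conv P U M i j z" for i j z
    using H_has_sum[of i j z] that unfolding M by (auto dest: has_sum_imp_summable infsumI)
  have K: "path_weight step_law (split_value z w) i summable_on steps.paths F i"
    "infsum (path_weight step_law (split_value z w) i) (steps.paths F i) = K_fun P U F i z w"
    if "K_conv P U F i z w" for i z w
    using K_has_sum[OF that] by (auto dest: has_sum_imp_summable infsumI)
  note G = G[folded M] and GF = GF[folded M] and H = H[folded M] and K = K[folded M]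
  note system = steps.sojourn_gf_system[folded M] and nonneg = steps.nonneg_gf[folded M]
    and negative = steps.negative_gf[folded M] and hitting = steps.hitting_gf_system[folded M]
  show ?thesis
  proof (intro conjI ballI impI allI; (elim conjE)?)
    fix i assume "i \<in> {0..M-1}" and
      "\<forall>j\<in>{0..M-1}. K_conv P U F j x y \<and> K_conv P U F j x 0 \<and>
         (\<forall>k\<in>{M..2*M-1}. H_conv P U M k j x) \<and> (\<forall>k\<in>{-M..-1}. H_conv P U M k j y)"
      and "K_conv P U F i 0 y"
    then show "K_fun P U F i x y =
          x * (\<Sum>j=0..M-1.
                (trans_prob P L R U i j
                 + (\<Sum>k=M..2*M-1. trans_prob P L R U i k * H_fun P U M k j x)
                 + (\<Sum>k=-M..-1. trans_prob P L R U i k * H_fun P U M k j y))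
                * K_fun P U F j x y)
          + K_fun P U F i x 0 + K_fun P U F i 0 y - indicator F i
          - x * (\<Sum>j=0..M-1.
                (trans_prob P L R U i j
                 + (\<Sum>k=M..2*M-1. trans_prob P L R U i k * H_fun P U M k j x))
                * K_fun P U F j x 0)"
      using system[of i x y F] by (simp add: K H trans_prob_def)
  next
    fix i assume "i \<in> {0..M-1}" and "K_conv P U F i x 0" "GF_conv P U F i x"
      "\<forall>j\<in>{0..M-1}. H_conv P U M (i + M) j x \<and> GF_conv P U F (j - M) x"
    then show "K_fun P U F i x 0 = GF_fun P U F i x -
        (\<Sum>j=0..M-1. H_fun P U M (i + M) j x * GF_fun P U F (j - M) x)"
      using nonneg[of i x F] by (simp add: K H GF)
  next
    fix i assume "i \<in> {0..M-1}" and "K_conv P U F i 0 y" "\<forall>j\<in>{0..2*M-1}. GF_conv P U F j y"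
      "\<forall>j\<in>{0..M-1}. \<forall>k\<in>{-M..-1}. H_conv P U M k j y"
    then show "K_fun P U F i 0 y =
          GF_fun P U F i y - y * (\<Sum>j=0..2*M-1. trans_prob P L R U i j * GF_fun P U F j y)
          - y * (\<Sum>j=0..M-1. \<Sum>k=-M..-1.
                   trans_prob P L R U i k * H_fun P U M k j y * GF_fun P U F j y)"
      using negative[of i y F] by (simp add: K H GF trans_prob_def)
  next
    fix i j assume "i \<in> {M..2*M-1}" "j \<in> {0..M-1}"
      "\<forall>k\<in>{0..M-1}. H_conv P U M i k x \<and> G_conv P U k j x" "G_conv P U i j x"
    then show "(\<Sum>k=0..M-1. H_fun P U M i k x * G_fun P U k j x) = G_fun P U i j x"
      using hitting[of i j x] by (simp add: G H)
  next
    fix i j assume "i \<in> {-M..-1}" "j \<in> {0..M-1}"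
      "\<forall>k\<in>{0..M-1}. H_conv P U M i k y \<and> G_conv P U k j y" "G_conv P U i j y"
    then show "(\<Sum>k=0..M-1. H_fun P U M i k y * G_fun P U k j y) = G_fun P U i j y"
      using hitting[of i j y] by (simp add: G H)
  qed (rule G_conv_inside GF_conv_inside H_conv_inside K_conv_inside; assumption)+
qed

end
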